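(* Let $\mathcal{S}$ be the set of all set partition statistics, thought of as functions $f:\bigcup_{n\ge 0}\Pi(n)\to\mathbb{Q}$. Then $\mathcal{S}$ is closed under pointwise scaling, addition and multiplication: if $f_1,f_2\in\mathcal{S}$ and $a\in\mathbb{Q}$, then there exist statistics $g_a,g_+,g_*\in\mathcal{S}$ such that for every set partition $\lambda$, $$a f_1(\lambda)=g_a(\lambda),\qquad f_1(\lambda)+f_2(\lambda)=g_+(\lambda),\qquad f_1(\lambda)f_2(\lambda)=g_*(\lambda).$$ Furthermore $\deg(g_a)\le\deg(f_1)$, $\deg(g_+)\le\max(\deg(f_1),\deg(f_2))$ and $\deg(g_* )\le\deg(f_1)+\deg(f_2)$. In particular $\mathcal{S}$ is a filtered $\mathbb{Q}$-algebra under these operations.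
   Context: For $n\ge 0$, $\Pi(n)$ is the set of set partitions of $[n]=\{1,\dots,n\}$. For $\lambda\in\Pi(n)$ write $i\sim_\lambda j$ if $i,j$ lie in the same block of $\lambda$. Let $\mathbf{First}(\lambda)$ be the set of elements of $[n]$ that are the smallest in their block, $\mathbf{Last}(\lambda)$ the set of elements that are the largest in their block, and $\mathbf{Arc}(\lambda)$ the set of pairs $(i,j)$ with $i<j$, $i\sim_\lambda j$, and $j$ the smallest element of the block of $i$ that is greater than $i$. A pattern of length $k$ is a tuple $\underline{P}=(P,\mathbf{F},\mathbf{L},\mathbf{A},\mathbf{C})$ where $P$ is a set partition of $[k]$, $\mathbf{F},\mathbf{L}\subseteq[k]$ and $\mathbf{A},\mathbf{C}\subseteq[k]\times[k]$. An occurrence of $\underline P$ in $\lambda\in\Pi(n)$ is a tuple $s=(x_1,\dots,x_k)$ with $x_i\in[n]$ such that: (1) $x_1<x_2<\dots<x_k$; (2) $x_i\sim_\lambda x_j$ iff $i\sim_P j$; (3) $x_i\in\mathbf{First}(\lambda)$ if $i\in\mathbf F$; (4) $x_i\in\mathbf{Last}(\lambda)$ if $i\in\mathbf L$; (5) $(x_i,x_j)\in\mathbf{Arc}(\lambda)$ if $(i,j)\in\mathbf A$; (6) $|x_i-x_j|=1$ if $(i,j)\in\mathbf C$. A simple statistic is determined by a pattern $\underline P$ of length $k$ and a polynomial $Q\in\mathbb{Z}[y_1,\dots,y_k,m]$: for $\lambda\in\Pi(n)$, $f_{\underline P,Q}(\lambda)=\sum_{s}Q(x_1,\dots,x_k,n)$,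 the sum over all occurrences $s=(x_1,\dots,x_k)$ of $\underline P$ in $\lambda$. Its degree is $k+\deg Q$. A statistic is a finite $\mathbb{Q}$-linear combination of simple statistics; its degree is the minimum, over all such representations, of the maximum degree of a simple statistic appearing in the representation. *)

theory Defs
  imports
    Complex_Main
    "HOL-Library.Disjoint_Sets"
    "HOL-Library.FuncSet"
    "HOL-Library.Function_Algebras"
    "HOL-Library.Poly_Mapping"
begin

section \<open>Set partitions\<close>

text \<open>The type below is the union over all n of the sets of set partitions of [n]. The number n is
  recovered from the blocks, as the number of elements they cover; the only partition of the empty
  set is the empty one.\<close>

typedef set_partition = "{B :: nat set set. \<exists>n. partition_on {1..n} B}"
  morphisms blocks Set_partition
  by (auto intro!: exI[of _ "{}"] exI[of _ "0::nat"] simp: partition_on_def)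

definition psize :: "set_partition \<Rightarrow> nat" where
  "psize l = card (\<Union> (blocks l))"

lemma partition_on_blocks: "partition_on {1..psize l} (blocks l)"
proof -
  obtain n where n: "partition_on {1..n} (blocks l)"
    using blocks[of l] by blast
  then have "\<Union> (blocks l) = {1..n}"
    by (simp add: partition_on_def)
  with n show ?thesis
    by (simp add: psize_def)
qed

lemma ex_set_partition:
  assumes "partition_on {1..n} B"
  shows "\<exists>l. blocks l = B \<and> psize l = n"
proof -
  have "blocks (Set_partition B) = B"
    using assms by (intro Set_partition_inverse) blast
  moreover have "\<Union> B = {1..n}"
    using assms by (simp add: partition_on_def)
  ultimately show ?thesis
    by (metis psize_def card_atLeastAtMost add_diff_cancel_right' Suc_eq_plus1)
qed

definition same_block :: "set_partition \<Rightarrow> nat \<Rightarrow> nat \<Rightarrow> bool" where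
  "same_block l i j \<longleftrightarrow> (\<exists>B\<in>blocks l. i \<in> B \<and> j \<in> B)"

definition First :: "set_partition \<Rightarrow> nat set" where
  "First l = {i \<in> {1..psize l}. \<forall>j. same_block l i j \<longrightarrow> i \<le> j}"

definition Last :: "set_partition \<Rightarrow> nat set" where
  "Last l = {i \<in> {1..psize l}. \<forall>j. same_block l i j \<longrightarrow> j \<le> i}"

definition Arc :: "set_partition \<Rightarrow> (nat \<times> nat) set" where
  "Arc l = {(i, j). i < j \<and> same_block l i j \<and> (\<forall>h. same_block l i h \<and> i < h \<longrightarrow> j \<le> h)}"


section \<open>Patterns and occurrences\<close>

record pattern =
  pat_part :: set_partition
  pat_F :: "nat set"
  pat_L :: "nat set"
  pat_A :: "(nat \<times> nat) set"
  pat_C :: "(nat \<times> nat) set"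

definition pat_length :: "pattern \<Rightarrow> nat" where
  "pat_length P = psize (pat_part P)"

definition is_pattern :: "pattern \<Rightarrow> bool" where
  "is_pattern P \<longleftrightarrow>
     pat_F P \<subseteq> {1..pat_length P} \<and>
     pat_L P \<subseteq> {1..pat_length P} \<and>
     pat_A P \<subseteq> {1..pat_length P} \<times> {1..pat_length P} \<and>
     pat_C P \<subseteq> {1..pat_length P} \<times> {1..pat_length P}"

text \<open>A tuple \<open>(x\<^sub>1, \<dots>, x\<^sub>k)\<close> is an extensional function on \<open>{1..k}\<close>, so that distinct
  functions are distinct tuples.\<close>

definition occurrences :: "pattern \<Rightarrow> set_partition \<Rightarrow> (nat \<Rightarrow> nat) set" where
  "occurrences P l =
     {x \<in> {1..pat_length P} \<rightarrow>\<^sub>E {1..psize l}.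
        strict_mono_on {1..pat_length P} x \<and>
        (\<forall>i\<in>{1..pat_length P}. \<forall>j\<in>{1..pat_length P}.
           same_block l (x i) (x j) \<longleftrightarrow> same_block (pat_part P) i j) \<and>
        (\<forall>i\<in>pat_F P. x i \<in> First l) \<and>
        (\<forall>i\<in>pat_L P. x i \<in> Last l) \<and>
        (\<forall>(i, j)\<in>pat_A P. (x i, x j) \<in> Arc l) \<and>
        (\<forall>(i, j)\<in>pat_C P. \<bar>int (x i) - int (x j)\<bar> = 1)}"


section \<open>Integer polynomials in finitely many variables\<close>

text \<open>Monomials are finitely supported exponent vectors. In a polynomial in \<open>y\<^sub>1, \<dots>, y\<^sub>k, m\<close>,
  index \<open>i \<ge> 1\<close> stands for \<open>y\<^sub>i\<close> and index \<open>0\<close> for \<open>m\<close>.\<close>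

type_synonym int_mpoly = "(nat \<Rightarrow>\<^sub>0 nat) \<Rightarrow>\<^sub>0 int"

definition mpoly_eval :: "(nat \<Rightarrow> int) \<Rightarrow> int_mpoly \<Rightarrow> int" where
  "mpoly_eval v Q =
     (\<Sum>e\<in>Poly_Mapping.keys Q. Poly_Mapping.lookup Q e *
        (\<Prod>i\<in>Poly_Mapping.keys e. v i ^ Poly_Mapping.lookup e i))"

definition mpoly_vars :: "int_mpoly \<Rightarrow> nat set" where
  "mpoly_vars Q = (\<Union>e\<in>Poly_Mapping.keys Q. Poly_Mapping.keys e)"

text \<open>Total degree, with the convention that the zero polynomial has degree 0.\<close>

definition mpoly_degree :: "int_mpoly \<Rightarrow> nat" where
  "mpoly_degree Q =
     Max (insert 0 ((\<lambda>e. \<Sum>i\<in>Poly_Mapping.keys e. Poly_Mapping.lookup e i) ` Poly_Mapping.keys Q))"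


section \<open>Statistics\<close>

definition simple_data :: "(pattern \<times> int_mpoly) set" where
  "simple_data = {(P, Q). is_pattern P \<and> mpoly_vars Q \<subseteq> {0..pat_length P}}"

definition simple_stat :: "pattern \<times> int_mpoly \<Rightarrow> set_partition \<Rightarrow> rat" where
  "simple_stat = (\<lambda>(P, Q) l.
     \<Sum>x\<in>occurrences P l.
       of_int (mpoly_eval (\<lambda>i. if i = 0 then int (psize l) else int (x i)) Q))"

definition simple_degree :: "pattern \<times> int_mpoly \<Rightarrow> nat" where
  "simple_degree = (\<lambda>(P, Q). pat_length P + mpoly_degree Q)"

definition represents ::
    "(pattern \<times> int_mpoly) set \<Rightarrow> (pattern \<times> int_mpoly \<Rightarrow> rat) \<Rightarrow> (set_partition \<Rightarrow> rat) \<Rightarrow> bool"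
where
  "represents T c f \<longleftrightarrow>
     finite T \<and> T \<subseteq> simple_data \<and> (\<forall>l. f l = (\<Sum>t\<in>T. c t * simple_stat t l))"

definition statistics :: "(set_partition \<Rightarrow> rat) set" where
  "statistics = {f. \<exists>T c. represents T c f}"

text \<open>The inserted 0 only matters for the empty combination, which represents the zero statistic.\<close>

definition representation_degree :: "(pattern \<times> int_mpoly) set \<Rightarrow> nat" where
  "representation_degree T = Max (insert 0 (simple_degree ` T))"

definition stat_degree :: "(set_partition \<Rightarrow> rat) \<Rightarrow> nat" where
  "stat_degree f = (LEAST d. \<exists>T c. represents T c f \<and> representation_degree T = d)"


section \<open>Filtered algebras\<close>

text \<open>\<open>A\<close> is a unital subalgebra of an ambient algebra over a field, exhaustively filtered by the
  increasing family \<open>F\<close>.\<close>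

definition filtered_algebra ::
    "('k::field \<Rightarrow> 'a::ring_1 \<Rightarrow> 'a) \<Rightarrow> 'a set \<Rightarrow> (nat \<Rightarrow> 'a set) \<Rightarrow> bool" where
  "filtered_algebra scale A F \<longleftrightarrow>
     vector_space scale \<and>
     (\<forall>a x y. scale a (x * y) = scale a x * y \<and> scale a (x * y) = x * scale a y) \<and>
     module.subspace scale A \<and> 1 \<in> A \<and> (\<forall>x\<in>A. \<forall>y\<in>A. x * y \<in> A) \<and>
     (\<forall>d. module.subspace scale (F d)) \<and>
     (\<forall>d e. d \<le> e \<longrightarrow> F d \<subseteq> F e) \<and>
     (\<Union>d. F d) = A \<and>
     1 \<in> F 0 \<and>
     (\<forall>d e. \<forall>x\<in>F d. \<forall>y\<in>F e. x * y \<in> F (d + e))"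

end

theory Submission
  imports Defs "HOL-Library.Infinite_Set"
begin

text \<open>The content is in the product of two simple statistics. A pair of occurrences
  \<open>x\<close> of \<open>P\<close> and \<open>x'\<close> of \<open>P'\<close> in \<open>\<lambda>\<close> is recorded by the increasing enumeration
  \<open>u\<^sub>1 < \<dots> < u\<^sub>r\<close> of the union of their entries, the positions \<open>\<alpha>\<close>, \<open>\<beta>\<close> of the two tuples
  inside \<open>u\<close>, and the partition \<open>R\<close> of \<open>[r]\<close> that \<open>\<lambda>\<close> induces along \<open>u\<close>. For fixed
  \<open>(\<alpha>, \<beta>, R)\<close>, of which there are finitely many, the tuples \<open>u\<close> are exactly the occurrences of
  one pattern of length \<open>r \<le> k + k'\<close>, and the summand becomes the polynomial
  \<open>Q(y\<^sub>\<alpha>, m) Q'(y\<^sub>\<beta>, m)\<close> of degree at most \<open>deg Q + deg Q'\<close>.\<close>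

section \<open>Evaluation of polynomials\<close>

definition monom_eval :: "(nat \<Rightarrow> int) \<Rightarrow> (nat \<Rightarrow>\<^sub>0 nat) \<Rightarrow> int" where
  "monom_eval v e = (\<Prod>i\<in>Poly_Mapping.keys e. v i ^ Poly_Mapping.lookup e i)"

definition monom_degree :: "(nat \<Rightarrow>\<^sub>0 nat) \<Rightarrow> nat" where
  "monom_degree e = (\<Sum>i\<in>Poly_Mapping.keys e. Poly_Mapping.lookup e i)"

text \<open>Indices outside the support carry exponent 0 and contribute the factor 1. A common index
  set lets monomials with different supports be compared factor by factor.\<close>

lemma monom_eval_superset:
  assumes "finite S" "Poly_Mapping.keys e \<subseteq> S"
  shows "monom_eval v e = (\<Prod>i\<in>S. v i ^ Poly_Mapping.lookup e i)"
  unfolding monom_eval_def using assms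
  by (intro prod.mono_neutral_left) (auto simp: in_keys_iff)

lemma monom_degree_superset:
  assumes "finite S" "Poly_Mapping.keys e \<subseteq> S"
  shows "monom_degree e = (\<Sum>i\<in>S. Poly_Mapping.lookup e i)"
  unfolding monom_degree_def using assms
  by (intro sum.mono_neutral_left) (auto simp: in_keys_iff)

text \<open>Exponents are natural numbers, so nothing cancels in the sum and equality holds, not
  just inclusion.\<close>

lemma keys_add_exponents:
  "Poly_Mapping.keys (e + e') = Poly_Mapping.keys e \<union> Poly_Mapping.keys (e' :: nat \<Rightarrow>\<^sub>0 nat)"
  by (auto simp: in_keys_iff lookup_add)

lemma monom_eval_add: "monom_eval v (e + e') = monom_eval v e * monom_eval v e'"
proof -
  let ?S = "Poly_Mapping.keys e \<union> Poly_Mapping.keys e'"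
  show ?thesis
    by (simp add: monom_eval_superset[of ?S] keys_add_exponents lookup_add power_add
        prod.distrib)
qed

lemma monom_degree_add: "monom_degree (e + e') = monom_degree e + monom_degree e'"
proof -
  let ?S = "Poly_Mapping.keys e \<union> Poly_Mapping.keys e'"
  show ?thesis
    by (simp add: monom_degree_superset[of ?S] keys_add_exponents lookup_add sum.distrib)
qed

lemma mpoly_eval_monom:
  "mpoly_eval v Q = (\<Sum>e\<in>Poly_Mapping.keys Q. Poly_Mapping.lookup Q e * monom_eval v e)"
  by (simp add: mpoly_eval_def monom_eval_def)

lemma mpoly_eval_superset:
  assumes "finite S" "Poly_Mapping.keys Q \<subseteq> S"
  shows "mpoly_eval v Q = (\<Sum>e\<in>S. Poly_Mapping.lookup Q e * monom_eval v e)"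
  unfolding mpoly_eval_monom using assms
  by (intro sum.mono_neutral_left) (auto simp: in_keys_iff)

lemma mpoly_eval_cong:
  assumes "\<And>i. i \<in> mpoly_vars Q \<Longrightarrow> v i = w i"
  shows "mpoly_eval v Q = mpoly_eval w Q"
proof -
  have "v i = w i" if "e \<in> Poly_Mapping.keys Q" "i \<in> Poly_Mapping.keys e" for e i
    using that by (intro assms) (auto simp: mpoly_vars_def)
  then show ?thesis by (simp add: mpoly_eval_def)
qed

lemma mpoly_degree_le_iff:
  "mpoly_degree Q \<le> d \<longleftrightarrow> (\<forall>e\<in>Poly_Mapping.keys Q. monom_degree e \<le> d)"
  by (auto simp: mpoly_degree_def monom_degree_def)

section \<open>Renaming variables and multiplying polynomials\<close>

text \<open>Each variable is replaced by its image under \<sigma>. Variables with the same image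
  have their exponents added, so the degree is preserved even when \<sigma> is not
  injective.\<close>

lemma monom_rename_exists:
  fixes \<sigma> :: "nat \<Rightarrow> nat" and e :: "nat \<Rightarrow>\<^sub>0 nat"
  shows "\<exists>e'. (\<forall>v. monom_eval v e' = monom_eval (v \<circ> \<sigma>) e) \<and>
              Poly_Mapping.keys e' \<subseteq> \<sigma> ` Poly_Mapping.keys e \<and> monom_degree e' = monom_degree e"
proof -
  define e' where "e' = (\<Sum>i\<in>Poly_Mapping.keys e.
    Poly_Mapping.single (\<sigma> i) (Poly_Mapping.lookup e i))"
  \<comment> \<open>The support of \<open>e\<close> is decoupled from its exponents here: induction
    on the index set \<open>A\<close> keeps \<open>k\<close> fixed, whereas removing an index from
    the support would change \<open>e\<close>.\<close>
  have gen: "(\<forall>v. monom_eval v (\<Sum>i\<in>A. Poly_Mapping.single (\<sigma> i) (k i)) = (\<Prod>i\<in>A. v (\<sigma> i) ^ k i)) \<and>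
      Poly_Mapping.keys (\<Sum>i\<in>A. Poly_Mapping.single (\<sigma> i) (k i)) \<subseteq> \<sigma> ` A \<and>
      monom_degree (\<Sum>i\<in>A. Poly_Mapping.single (\<sigma> i) (k i)) = (\<Sum>i\<in>A. k i)"
    if "finite A" for A and k :: "nat \<Rightarrow> nat"
    using that
  proof (induction A rule: finite_induct)
    case empty
    show ?case by (simp add: monom_eval_def monom_degree_def)
  next
    case (insert a A)
    have "monom_eval v (Poly_Mapping.single (\<sigma> a) (k a)) = v (\<sigma> a) ^ k a" for v
      by (simp add: monom_eval_superset[of "{\<sigma> a}"])
    moreover have "monom_degree (Poly_Mapping.single (\<sigma> a) (k a)) = k a"
      by (simp add: monom_degree_superset[of "{\<sigma> a}"])
    ultimately show ?case using insert
      by (auto simp: monom_eval_add monom_degree_add keys_add_exponents split: if_splits)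
  qed
  from gen[of "Poly_Mapping.keys e" "Poly_Mapping.lookup e"] show ?thesis
    by (intro exI[of _ e']) (auto simp: e'_def monom_eval_def monom_degree_def)
qed

text \<open>Like terms are collected: the exponents \<open>e a\<close> may coincide, and then their
  coefficients add up and may cancel. Hence variables and degree are only bounded from
  above.\<close>

lemma mpoly_sum_exists:
  assumes "finite A"
    and "\<And>a. a \<in> A \<Longrightarrow> Poly_Mapping.keys (e a) \<subseteq> W"
    and "\<And>a. a \<in> A \<Longrightarrow> monom_degree (e a) \<le> d"
  shows "\<exists>Q. (\<forall>v. mpoly_eval v Q = (\<Sum>a\<in>A. c a * monom_eval v (e a))) \<and>
             mpoly_vars Q \<subseteq> W \<and> mpoly_degree Q \<le> d"
proof -
  define Q where "Q = (\<Sum>a\<in>A. Poly_Mapping.single (e a) (c a))"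
  have keys: "Poly_Mapping.keys Q \<subseteq> e ` A"
    unfolding Q_def using keys_sum[of "\<lambda>a. Poly_Mapping.single (e a) (c a)" A]
    by (auto split: if_splits)
  have "mpoly_eval v Q = (\<Sum>a\<in>A. c a * monom_eval v (e a))" for v
  proof -
    have "mpoly_eval v Q =
        (\<Sum>b\<in>e ` A. (\<Sum>a\<in>A. Poly_Mapping.lookup (Poly_Mapping.single (e a) (c a)) b) * monom_eval v b)"
      using assms(1) keys by (simp add: mpoly_eval_superset[of "e ` A"] Q_def lookup_sum)
    \<comment> \<open>After exchanging the sums, each \<open>a\<close> contributes to the single
      exponent \<open>b = e a\<close>.\<close>
    also have "\<dots> = (\<Sum>a\<in>A. \<Sum>b\<in>e ` A. if b = e a then c a * monom_eval v b else 0)"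
      unfolding sum_distrib_right
      by (subst sum.swap) (auto simp: lookup_single when_def intro!: sum.cong)
    also have "\<dots> = (\<Sum>a\<in>A. c a * monom_eval v (e a))"
      using assms(1) by (intro sum.cong refl) simp
    finally show ?thesis .
  qed
  moreover have "mpoly_vars Q \<subseteq> W"
    using keys assms(2) by (fastforce simp: mpoly_vars_def)
  moreover have "mpoly_degree Q \<le> d"
    using keys assms(3) by (auto simp: mpoly_degree_le_iff)
  ultimately show ?thesis by blast
qed

text \<open>Both polynomials are renamed monomial by monomial and the product is expanded over pairs
  of exponents. In the application \<sigma> and \<tau> send the indices of two tuples to their
  positions in the merged tuple.\<close>

lemma mpoly_rename_mult_exists:
  assumes "\<sigma> ` mpoly_vars Q \<subseteq> W" "\<tau> ` mpoly_vars Q' \<subseteq> W"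
  shows "\<exists>S. (\<forall>v. mpoly_eval v S = mpoly_eval (v \<circ> \<sigma>) Q * mpoly_eval (v \<circ> \<tau>) Q') \<and>
             mpoly_vars S \<subseteq> W \<and> mpoly_degree S \<le> mpoly_degree Q + mpoly_degree Q'"
proof -
  have "\<forall>e. \<exists>e'. (\<forall>v. monom_eval v e' = monom_eval (v \<circ> \<sigma>) e) \<and>
      Poly_Mapping.keys e' \<subseteq> \<sigma> ` Poly_Mapping.keys e \<and> monom_degree e' = monom_degree e" for \<sigma>
    using monom_rename_exists by blast
  then have "\<exists>r. \<forall>e. (\<forall>v. monom_eval v (r e) = monom_eval (v \<circ> \<sigma>) e) \<and>
      Poly_Mapping.keys (r e) \<subseteq> \<sigma> ` Poly_Mapping.keys e \<and> monom_degree (r e) = monom_degree e" for \<sigma>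
    by (rule choice)
  then obtain r where
    r: "\<And>\<sigma> e v. monom_eval v (r \<sigma> e) = monom_eval (v \<circ> \<sigma>) e"
       "\<And>\<sigma> e. Poly_Mapping.keys (r \<sigma> e) \<subseteq> \<sigma> ` Poly_Mapping.keys e"
       "\<And>\<sigma> e. monom_degree (r \<sigma> e) = monom_degree e"
    by metis
  let ?A = "Poly_Mapping.keys Q \<times> Poly_Mapping.keys Q'"
  have "Poly_Mapping.keys (r \<sigma> (fst a) + r \<tau> (snd a)) \<subseteq> W" if "a \<in> ?A" for a
  proof -
    have "Poly_Mapping.keys (fst a) \<subseteq> mpoly_vars Q" "Poly_Mapping.keys (snd a) \<subseteq> mpoly_vars Q'"
      using that by (auto simp: mpoly_vars_def)
    then have "Poly_Mapping.keys (r \<sigma> (fst a)) \<subseteq> W" "Poly_Mapping.keys (r \<tau> (snd a)) \<subseteq> W"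
      using r(2)[of \<sigma> "fst a"] r(2)[of \<tau> "snd a"] assms by blast+
    then show ?thesis by (simp add: keys_add_exponents)
  qed
  moreover have "monom_degree (r \<sigma> (fst a) + r \<tau> (snd a)) \<le> mpoly_degree Q + mpoly_degree Q'"
    if "a \<in> ?A" for a
    using that mpoly_degree_le_iff[of Q "mpoly_degree Q"] mpoly_degree_le_iff[of Q' "mpoly_degree Q'"]
    by (auto simp: monom_degree_add r(3) intro!: add_mono)
  ultimately have "\<exists>S. (\<forall>v. mpoly_eval v S = (\<Sum>a\<in>?A.
        (Poly_Mapping.lookup Q (fst a) * Poly_Mapping.lookup Q' (snd a)) *
        monom_eval v (r \<sigma> (fst a) + r \<tau> (snd a)))) \<and>
      mpoly_vars S \<subseteq> W \<and> mpoly_degree S \<le> mpoly_degree Q + mpoly_degree Q'"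
    by (intro mpoly_sum_exists) auto
  moreover have "(\<Sum>a\<in>?A. (Poly_Mapping.lookup Q (fst a) * Poly_Mapping.lookup Q' (snd a)) *
        monom_eval v (r \<sigma> (fst a) + r \<tau> (snd a))) =
      mpoly_eval (v \<circ> \<sigma>) Q * mpoly_eval (v \<circ> \<tau>) Q'" for v
    by (simp add: mpoly_eval_monom sum_product sum.cartesian_product monom_eval_add r(1)
        case_prod_unfold ac_simps)
  ultimately show ?thesis by simp
qed


section \<open>Set partitions and increasing enumerations\<close>

lemma same_block_equiv:
  "equiv {1..psize l} {(i, j). same_block l i j}"
  using equiv_partition_on[OF partition_on_blocks[of l]]
  by (simp add: same_block_def)

lemma same_block_range:
  assumes "same_block l i j"
  shows "i \<in> {1..psize l}" "j \<in> {1..psize l}"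
  using equiv_type[OF same_block_equiv[of l]] assms by auto

lemma same_block_refl: "i \<in> {1..psize l} \<Longrightarrow> same_block l i i"
  using same_block_equiv[of l] by (auto simp: equiv_def refl_on_def)

lemma same_block_sym: "same_block l i j \<Longrightarrow> same_block l j i"
  by (auto simp: same_block_def)

lemma same_block_trans: "same_block l i j \<Longrightarrow> same_block l j k \<Longrightarrow> same_block l i k"
  using same_block_equiv[of l] by (auto simp: equiv_def dest: transD)

text \<open>The blocks are the quotient of [n] by the relation \<open>same_block\<close>, which is
  false outside [n]; so this relation on [n] determines the partition.\<close>

lemma set_partition_eqI:
  assumes "psize l = psize l'"
    and "\<And>i j. i \<in> {1..psize l} \<Longrightarrow> j \<in> {1..psize l} \<Longrightarrow> same_block l i j \<longleftrightarrow> same_block l' i j"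
  shows "l = l'"
proof -
  have "same_block l i j \<longleftrightarrow> same_block l' i j" for i j
    using assms(2)[of i j] same_block_range[of l i j] same_block_range[of l' i j]
    unfolding assms(1) by blast
  then have "{(i, j). same_block l i j} = {(i, j). same_block l' i j}"
    by simp
  then have "blocks l = blocks l'"
    using partition_on_eq_quotient[OF partition_on_blocks[of l]]
      partition_on_eq_quotient[OF partition_on_blocks[of l']] assms(1)
    by (simp add: same_block_def)
  then show ?thesis by (simp add: blocks_inject)
qed

lemma finite_set_partitions_psize_le: "finite {l. psize l \<le> n}"
proof (rule inj_on_finite)
  show "inj_on blocks {l. psize l \<le> n}"
    by (simp add: inj_on_def blocks_inject)
  show "blocks ` {l. psize l \<le> n} \<subseteq> Pow (Pow {1..n})"
  proof clarify
    fix l B i assume *: "psize l \<le> n" "B \<in> blocks l" "i \<in> B"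
    then have "i \<in> \<Union> (blocks l)" by blast
    then have "i \<in> {1..psize l}"
      by (simp only: partition_onD1[OF partition_on_blocks[of l], symmetric])
    with *(1) show "i \<in> {1..n}" by simp
  qed
qed simp

text \<open>The block relation of \<open>l\<close> pulled back along \<open>u\<close> is an
  equivalence on [r], and \<open>R\<close> is its quotient.\<close>

lemma induced_partition_exists:
  assumes "u \<in> {1..r} \<rightarrow> {1..psize l}"
  shows "\<exists>R. psize R = r \<and>
    (\<forall>i\<in>{1..r}. \<forall>j\<in>{1..r}. same_block l (u i) (u j) \<longleftrightarrow> same_block R i j)"
proof -
  let ?E = "{(i, j). i \<in> {1..r} \<and> j \<in> {1..r} \<and> same_block l (u i) (u j)}"
  have E: "equiv {1..r} ?E"
  proof (rule equivI)
    show "?E \<subseteq> {1..r} \<times> {1..r}" by auto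
    show "refl_on {1..r} ?E"
    proof (rule refl_onI)
      fix i assume i: "i \<in> {1..r}"
      with assms have "u i \<in> {1..psize l}" by blast
      with i show "(i, i) \<in> ?E"
        by (simp add: same_block_refl)
    qed
    show "sym ?E"
      by (auto intro!: symI same_block_sym)
    show "trans ?E"
      by (auto intro!: transI intro: same_block_trans)
  qed
  obtain R where R: "blocks R = {1..r} // ?E" "psize R = r"
    using ex_set_partition[OF partition_on_quotient[OF E]] by blast
  have "same_block R i j \<longleftrightarrow> (i, j) \<in> ?E" for i j
  proof
    assume "same_block R i j"
    then obtain B where "B \<in> {1..r} // ?E" "i \<in> B" "j \<in> B"
      unfolding same_block_def R(1) by blast
    then show "(i, j) \<in> ?E"
      using in_quotient_imp_in_rel[OF E, of B i j] by blast
  next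
    assume "(i, j) \<in> ?E"
    then have "?E `` {i} \<in> blocks R" "i \<in> ?E `` {i}" "j \<in> ?E `` {i}"
      using equiv_class_self[OF E, of i] quotientI[of i "{1..r}" ?E] unfolding R(1) by blast+
    then show "same_block R i j" unfolding same_block_def[of R] by (intro bexI conjI)
  qed
  with R(2) show ?thesis by auto
qed

section \<open>Increasing enumerations of finite sets\<close>

text \<open>The values not exceeding \<open>u i\<close> are exactly those at 1, ..., i. The index of
  a value can thus be read off from the image set alone.\<close>

lemma strict_mono_on_rank:
  fixes u :: "nat \<Rightarrow> nat"
  assumes "strict_mono_on {1..r} u" "i \<in> {1..r}"
  shows "card {y \<in> u ` {1..r}. y \<le> u i} = i"
proof -
  have "{y \<in> u ` {1..r}. y \<le> u i} = u ` {j \<in> {1..r}. u j \<le> u i}" by blast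
  also have "{j \<in> {1..r}. u j \<le> u i} = {j \<in> {1..r}. j \<le> i}"
    using strict_mono_on_less_eq[OF assms(1) _ assms(2)] by blast
  also have "\<dots> = {1..i}" using assms(2) by auto
  finally have "{y \<in> u ` {1..r}. y \<le> u i} = u ` {1..i}" .
  moreover have "inj_on u {1..i}"
    by (rule inj_on_subset[OF strict_mono_on_imp_inj_on[OF assms(1)]]) (use assms(2) in auto)
  ultimately show ?thesis by (simp add: card_image)
qed

text \<open>If \<open>u i = u' j\<close>, then i and j are both the rank of this value in the common
  image, hence equal.\<close>

lemma strict_mono_on_image_unique:
  fixes u u' :: "nat \<Rightarrow> nat"
  assumes u: "strict_mono_on {1..r} u" and u': "strict_mono_on {1..r} u'"
    and im: "u ` {1..r} = u' ` {1..r}" and i: "i \<in> {1..r}"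
  shows "u i = u' i"
proof -
  have "u i \<in> u' ` {1..r}" unfolding im[symmetric] using i by (rule imageI)
  then obtain j where j: "j \<in> {1..r}" "u i = u' j" by blast
  have "i = card {y \<in> u ` {1..r}. y \<le> u i}"
    using strict_mono_on_rank[OF u i] by simp
  also have "\<dots> = j"
    using strict_mono_on_rank[OF u' j(1)] im j(2) by simp
  finally show ?thesis using j(2) by simp
qed

lemma strict_mono_enumeration_exists:
  assumes "finite (U :: nat set)"
  shows "\<exists>u \<in> {1..card U} \<rightarrow>\<^sub>E U. strict_mono_on {1..card U} u \<and> u ` {1..card U} = U"
proof -
  obtain h where h: "bij_betw h {..<card U} U" "strict_mono_on {..<card U} h"
    by (rule ex_bij_betw_strict_mono_card[OF assms])
  \<comment> \<open>The enumeration \<open>h\<close> starts at 0 while tuples start at 1, hence the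
    shift. The restriction makes \<open>u\<close> extensional, as tuples are required to be.\<close>
  define u where "u = (\<lambda>i\<in>{1..card U}. h (i - 1))"
  have "u ` {1..card U} = h ` {..<card U}"
  proof -
    have "u ` {1..card U} = h ` ((\<lambda>i. i - 1) ` {1..card U})"
      unfolding u_def image_image by (intro image_cong) simp_all
    also have "(\<lambda>i. i - 1) ` {1..card U} = {..<card U}"
    proof (intro equalityI subsetI)
      fix i assume "i \<in> {..<card U}"
      then show "i \<in> (\<lambda>i. i - 1) ` {1..card U}"
        by (intro image_eqI[of _ _ "Suc i"]) auto
    next
      fix i assume "i \<in> (\<lambda>i. i - 1) ` {1..card U}"
      then obtain j where "j \<in> {1..card U}" "i = j - 1" by blast
      then show "i \<in> {..<card U}" by auto
    qed
    finally show ?thesis .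
  qed
  then have im: "u ` {1..card U} = U"
    using h(1) by (simp add: bij_betw_def)
  moreover have "strict_mono_on {1..card U} u"
    using h(2) by (intro strict_mono_onI) (simp add: u_def strict_mono_onD diff_less_mono)
  moreover have "u \<in> {1..card U} \<rightarrow>\<^sub>E U"
    using im by (intro PiE_I) (blast, auto simp: u_def)
  ultimately show ?thesis by blast
qed


section \<open>Merging two patterns\<close>

text \<open>These are conditions (1) and (2) of an occurrence, without the labels. They are
  separated because they serve twice: for tuples in the given partition, and for position maps into
  the small partition \<open>R\<close>.\<close>

definition embeds :: "(nat \<Rightarrow> nat) \<Rightarrow> pattern \<Rightarrow> set_partition \<Rightarrow> bool" where
  "embeds \<alpha> P R \<longleftrightarrow>
     \<alpha> \<in> {1..pat_length P} \<rightarrow>\<^sub>E {1..psize R} \<and> strict_mono_on {1..pat_length P} \<alpha> \<and>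
     (\<forall>i\<in>{1..pat_length P}. \<forall>j\<in>{1..pat_length P}.
        same_block R (\<alpha> i) (\<alpha> j) \<longleftrightarrow> same_block (pat_part P) i j)"

lemma embedsI:
  assumes "\<alpha> \<in> {1..pat_length P} \<rightarrow>\<^sub>E {1..psize R}"
    and "\<And>i j. i \<in> {1..pat_length P} \<Longrightarrow> j \<in> {1..pat_length P} \<Longrightarrow> i < j \<Longrightarrow> \<alpha> i < \<alpha> j"
    and "\<And>i j. i \<in> {1..pat_length P} \<Longrightarrow> j \<in> {1..pat_length P} \<Longrightarrow>
      same_block R (\<alpha> i) (\<alpha> j) \<longleftrightarrow> same_block (pat_part P) i j"
  shows "embeds \<alpha> P R"
  unfolding embeds_def using assms by (intro conjI ballI strict_mono_onI)

lemma embedsD: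
  assumes "embeds \<alpha> P R"
  shows "\<alpha> \<in> extensional {1..pat_length P}" "strict_mono_on {1..pat_length P} \<alpha>"
    and "i \<in> {1..pat_length P} \<Longrightarrow> \<alpha> i \<in> {1..psize R}"
    and "i \<in> {1..pat_length P} \<Longrightarrow> j \<in> {1..pat_length P} \<Longrightarrow>
      same_block R (\<alpha> i) (\<alpha> j) \<longleftrightarrow> same_block (pat_part P) i j"
  using assms unfolding embeds_def PiE_def by blast+

text \<open>The covering condition says that every entry of the merged tuple comes from one of the
  two tuples. It bounds the size of \<open>R\<close> and makes the merged tuple unique.\<close>

definition merge_data ::
    "pattern \<Rightarrow> pattern \<Rightarrow> ((nat \<Rightarrow> nat) \<times> (nat \<Rightarrow> nat) \<times> set_partition) set" where
  "merge_data P P' = {(\<alpha>, \<beta>, R). embeds \<alpha> P R \<and> embeds \<beta> P' R \<and>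
     \<alpha> ` {1..pat_length P} \<union> \<beta> ` {1..pat_length P'} = {1..psize R}}"

text \<open>The labels of both patterns are transported to the merged positions. The combined labels
  may be contradictory; the pattern then has no occurrences and contributes 0.\<close>

definition merge_pattern ::
    "pattern \<Rightarrow> pattern \<Rightarrow> (nat \<Rightarrow> nat) \<times> (nat \<Rightarrow> nat) \<times> set_partition \<Rightarrow> pattern" where
  "merge_pattern P P' = (\<lambda>(\<alpha>, \<beta>, R).
     \<lparr>pat_part = R,
      pat_F = \<alpha> ` pat_F P \<union> \<beta> ` pat_F P',
      pat_L = \<alpha> ` pat_L P \<union> \<beta> ` pat_L P',
      pat_A = map_prod \<alpha> \<alpha> ` pat_A P \<union> map_prod \<beta> \<beta> ` pat_A P',
      pat_C = map_prod \<alpha> \<alpha> ` pat_C P \<union> map_prod \<beta> \<beta> ` pat_C P'\<rparr>)"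

lemma pat_length_merge_pattern [simp]: "pat_length (merge_pattern P P' (\<alpha>, \<beta>, R)) = psize R"
  by (simp add: pat_length_def merge_pattern_def)

lemma merge_dataD:
  assumes "(\<alpha>, \<beta>, R) \<in> merge_data P P'"
  shows "embeds \<alpha> P R" "embeds \<beta> P' R"
    and "\<alpha> ` {1..pat_length P} \<union> \<beta> ` {1..pat_length P'} = {1..psize R}"
  using assms by (simp_all add: merge_data_def)

lemma merge_data_psize_le:
  assumes "(\<alpha>, \<beta>, R) \<in> merge_data P P'"
  shows "psize R \<le> pat_length P + pat_length P'"
proof -
  have "psize R = card (\<alpha> ` {1..pat_length P} \<union> \<beta> ` {1..pat_length P'})"
    using assms by (simp add: merge_data_def)
  also have "\<dots> \<le> card (\<alpha> ` {1..pat_length P}) + card (\<beta> ` {1..pat_length P'})"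
    by (rule card_Un_le)
  also have "\<dots> \<le> pat_length P + pat_length P'"
    using card_image_le[of "{1..pat_length P}" \<alpha>] card_image_le[of "{1..pat_length P'}" \<beta>] by simp
  finally show ?thesis .
qed

text \<open>The size of \<open>R\<close> is at most the sum of the two lengths, which leaves
  finitely many partitions and, by extensionality, finitely many position maps.\<close>

lemma finite_merge_data: "finite (merge_data P P')"
proof (rule finite_subset)
  let ?n = "pat_length P + pat_length P'"
  show "merge_data P P' \<subseteq> ({1..pat_length P} \<rightarrow>\<^sub>E {1..?n}) \<times> ({1..pat_length P'} \<rightarrow>\<^sub>E {1..?n}) \<times>
      {R. psize R \<le> ?n}"
  proof clarify
    fix \<alpha> \<beta> R assume d: "(\<alpha>, \<beta>, R) \<in> merge_data P P'"
    note le = merge_data_psize_le[OF d]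
    then have "{1..psize R} \<subseteq> {1..?n}" by auto
    then have "\<alpha> \<in> {1..pat_length P} \<rightarrow>\<^sub>E {1..?n}" "\<beta> \<in> {1..pat_length P'} \<rightarrow>\<^sub>E {1..?n}"
      using embedsD(1,3)[OF merge_dataD(1)[OF d]] embedsD(1,3)[OF merge_dataD(2)[OF d]]
      unfolding PiE_def by blast+
    with le show "\<alpha> \<in> {1..pat_length P} \<rightarrow>\<^sub>E {1..?n} \<and>
        (\<beta>, R) \<in> ({1..pat_length P'} \<rightarrow>\<^sub>E {1..?n}) \<times> {R. psize R \<le> ?n}" by simp
  qed
  show "finite (({1..pat_length P} \<rightarrow>\<^sub>E {1..?n}) \<times> ({1..pat_length P'} \<rightarrow>\<^sub>E {1..?n}) \<times>
      {R. psize R \<le> ?n})"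
    by (intro finite_cartesian_product finite_PiE finite_set_partitions_psize_le) auto
qed

lemma is_pattern_merge_pattern:
  assumes "is_pattern P" "is_pattern P'" "(\<alpha>, \<beta>, R) \<in> merge_data P P'"
  shows "is_pattern (merge_pattern P P' (\<alpha>, \<beta>, R))"
proof -
  have \<alpha>: "\<And>i. i \<in> {1..pat_length P} \<Longrightarrow> \<alpha> i \<in> {1..psize R}"
    and \<beta>: "\<And>i. i \<in> {1..pat_length P'} \<Longrightarrow> \<beta> i \<in> {1..psize R}"
    using merge_dataD[OF assms(3)] embedsD(3) by blast+
  have img: "f ` X \<subseteq> B" if "\<And>i. i \<in> A \<Longrightarrow> f i \<in> B" "X \<subseteq> A" for f :: "nat \<Rightarrow> nat" and A B X
    using that by blast
  have img2: "map_prod f f ` Y \<subseteq> B \<times> B"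
    if "\<And>i. i \<in> A \<Longrightarrow> f i \<in> B" "Y \<subseteq> A \<times> A" for f :: "nat \<Rightarrow> nat" and A B Y
    using that by auto
  show ?thesis
    using assms(1,2) unfolding is_pattern_def pat_length_merge_pattern
    unfolding merge_pattern_def prod.case pattern.simps
    by (intro conjI Un_least img[OF \<alpha>] img2[OF \<alpha>] img[OF \<beta>] img2[OF \<beta>]) (elim conjE, assumption)+
qed

text \<open>Conditions (3) to (6) of an occurrence, stated for an arbitrary function so that they
  apply to the non-extensional \<open>u \<circ> \<alpha>\<close> as well.\<close>

definition respects_labels :: "(nat \<Rightarrow> nat) \<Rightarrow> pattern \<Rightarrow> set_partition \<Rightarrow> bool" where
  "respects_labels x P l \<longleftrightarrow>
     (\<forall>i\<in>pat_F P. x i \<in> First l) \<and> (\<forall>i\<in>pat_L P. x i \<in> Last l) \<and>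
     (\<forall>(i, j)\<in>pat_A P. (x i, x j) \<in> Arc l) \<and>
     (\<forall>(i, j)\<in>pat_C P. \<bar>int (x i) - int (x j)\<bar> = 1)"

lemma occurrences_embeds:
  "x \<in> occurrences P l \<longleftrightarrow> embeds x P l \<and> respects_labels x P l"
  by (auto simp: occurrences_def embeds_def respects_labels_def)

lemma respects_labels_merge_pattern:
  "respects_labels u (merge_pattern P P' (\<alpha>, \<beta>, R)) l \<longleftrightarrow>
     respects_labels (u \<circ> \<alpha>) P l \<and> respects_labels (u \<circ> \<beta>) P' l"
  unfolding respects_labels_def merge_pattern_def by (simp add: ball_Un case_prod_unfold) blast

text \<open>All labels of a pattern lie in [k], so values elsewhere are irrelevant. This permits
  passing from \<open>u \<circ> \<alpha>\<close> to its extensional version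
  \<open>compose\<close>.\<close>

lemma respects_labels_cong:
  assumes "is_pattern P" "\<And>i. i \<in> {1..pat_length P} \<Longrightarrow> x i = y i"
  shows "respects_labels x P l \<longleftrightarrow> respects_labels y P l"
proof -
  have F: "\<forall>i\<in>pat_F P. x i = y i" and L: "\<forall>i\<in>pat_L P. x i = y i"
    and A: "\<forall>(i, j)\<in>pat_A P. x i = y i \<and> x j = y j"
    and C: "\<forall>(i, j)\<in>pat_C P. x i = y i \<and> x j = y j"
    using assms unfolding is_pattern_def by blast+
  have "(\<forall>(i, j)\<in>pat_A P. (x i, x j) \<in> Arc l) \<longleftrightarrow> (\<forall>(i, j)\<in>pat_A P. (y i, y j) \<in> Arc l)"
    using A by (intro ball_cong refl) auto
  moreover have "(\<forall>(i, j)\<in>pat_C P. \<bar>int (x i) - int (x j)\<bar> = 1) \<longleftrightarrow>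
      (\<forall>(i, j)\<in>pat_C P. \<bar>int (y i) - int (y j)\<bar> = 1)"
    using C by (intro ball_cong refl) auto
  ultimately show ?thesis
    using F L unfolding respects_labels_def by simp
qed

section \<open>Composing, factoring and cancelling embeddings\<close>

lemma embeds_compose:
  assumes "embeds u P' l" "embeds \<alpha> P R" "pat_part P' = R"
  shows "embeds (compose {1..pat_length P} u \<alpha>) P l"
proof (rule embedsI)
  have R: "psize R = pat_length P'" using assms(3) by (simp add: pat_length_def)
  have \<alpha>: "\<alpha> i \<in> {1..pat_length P'}" if "i \<in> {1..pat_length P}" for i
    using embedsD(3)[OF assms(2) that] R by simp
  show "compose {1..pat_length P} u \<alpha> \<in> {1..pat_length P} \<rightarrow>\<^sub>E {1..psize l}"
  proof (rule PiE_I)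
    fix i assume i: "i \<in> {1..pat_length P}"
    show "compose {1..pat_length P} u \<alpha> i \<in> {1..psize l}"
      unfolding compose_eq[OF i] by (intro embedsD(3)[OF assms(1)] \<alpha> i)
  qed (auto simp: compose_def)
  fix i j assume ij: "i \<in> {1..pat_length P}" "j \<in> {1..pat_length P}"
  note eq = compose_eq[OF ij(1)] compose_eq[OF ij(2)]
  show "compose {1..pat_length P} u \<alpha> i < compose {1..pat_length P} u \<alpha> j" if "i < j"
    unfolding eq
    by (intro strict_mono_onD[OF embedsD(2)[OF assms(1)]] strict_mono_onD[OF embedsD(2)[OF assms(2)]]
        \<alpha> ij that)
  show "same_block l (compose {1..pat_length P} u \<alpha> i) (compose {1..pat_length P} u \<alpha> j)
      \<longleftrightarrow> same_block (pat_part P) i j"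
    unfolding eq embedsD(4)[OF assms(1) \<alpha>[OF ij(1)] \<alpha>[OF ij(2)]] assms(3)
    by (rule embedsD(4)[OF assms(2) ij])
qed

text \<open>A converse to \<open>embeds_compose\<close>: \<alpha> records where each entry of
  \<open>x\<close> sits in \<open>u\<close>. It is increasing because \<open>u\<close> reflects the
  order, and it respects blocks because \<open>u\<close> and \<open>x\<close> do.\<close>

lemma embeds_factor:
  assumes "embeds u P' l" "embeds x P l" "pat_part P' = R"
    and "x ` {1..pat_length P} \<subseteq> u ` {1..psize R}"
  shows "\<exists>\<alpha>. embeds \<alpha> P R \<and> compose {1..pat_length P} u \<alpha> = x"
proof -
  define \<alpha> where "\<alpha> = (\<lambda>i\<in>{1..pat_length P}. inv_into {1..psize R} u (x i))"
  have R: "psize R = pat_length P'" using assms(3) by (simp add: pat_length_def)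
  have \<alpha>: "\<alpha> i \<in> {1..pat_length P'}" "u (\<alpha> i) = x i" if "i \<in> {1..pat_length P}" for i
  proof -
    have "x i \<in> u ` {1..psize R}" using that assms(4) by blast
    then have "inv_into {1..psize R} u (x i) \<in> {1..psize R}"
      "u (inv_into {1..psize R} u (x i)) = x i"
      by (rule inv_into_into, rule f_inv_into_f)
    then show "\<alpha> i \<in> {1..pat_length P'}" "u (\<alpha> i) = x i"
      unfolding \<alpha>_def restrict_apply'[OF that] R[symmetric] .
  qed
  have "embeds \<alpha> P R"
  proof (rule embedsI)
    show "\<alpha> \<in> {1..pat_length P} \<rightarrow>\<^sub>E {1..psize R}"
      unfolding R by (intro PiE_I \<alpha>(1)) (auto simp: \<alpha>_def)
    fix i j assume ij: "i \<in> {1..pat_length P}" "j \<in> {1..pat_length P}"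
    show "\<alpha> i < \<alpha> j" if "i < j"
      using strict_mono_on_less[OF embedsD(2)[OF assms(1)] \<alpha>(1)[OF ij(1)] \<alpha>(1)[OF ij(2)]]
        strict_mono_onD[OF embedsD(2)[OF assms(2)] ij that] \<alpha>(2)[OF ij(1)] \<alpha>(2)[OF ij(2)] by simp
    show "same_block R (\<alpha> i) (\<alpha> j) \<longleftrightarrow> same_block (pat_part P) i j"
      using embedsD(4)[OF assms(1) \<alpha>(1)[OF ij(1)] \<alpha>(1)[OF ij(2)]]
        embedsD(4)[OF assms(2) ij] \<alpha>(2)[OF ij(1)] \<alpha>(2)[OF ij(2)] assms(3) by simp
  qed
  moreover have "compose {1..pat_length P} u \<alpha> = x"
  proof (rule extensionalityI)
    show "x \<in> extensional {1..pat_length P}" by (rule embedsD(1)[OF assms(2)])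
    show "compose {1..pat_length P} u \<alpha> i = x i" if "i \<in> {1..pat_length P}" for i
      unfolding compose_eq[OF that] by (rule \<alpha>(2)[OF that])
  qed (rule compose_extensional)
  ultimately show ?thesis by blast
qed

text \<open>By the covering condition, the entries of \<open>u\<close> are recovered from the pair
  of tuples; injectivity of the merging bijection starts from this.\<close>

lemma merged_occurrence_image:
  assumes "(\<alpha>, \<beta>, R) \<in> merge_data P P'"
  shows "u ` {1..psize R} = compose {1..pat_length P} u \<alpha> ` {1..pat_length P} \<union>
    compose {1..pat_length P'} u \<beta> ` {1..pat_length P'}"
proof -
  have "u ` {1..psize R} = u ` (\<alpha> ` {1..pat_length P} \<union> \<beta> ` {1..pat_length P'})"
    using assms by (simp add: merge_data_def)
  then show ?thesis by (simp add: image_Un image_image compose_eq)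
qed

lemma embeds_left_cancel:
  assumes "inj_on u {1..psize R}" "embeds \<alpha> P R" "embeds \<alpha>' P R"
    and "compose {1..pat_length P} u \<alpha> = compose {1..pat_length P} u \<alpha>'"
  shows "\<alpha> = \<alpha>'"
proof (rule extensionalityI)
  show "\<alpha> \<in> extensional {1..pat_length P}" "\<alpha>' \<in> extensional {1..pat_length P}"
    by (rule embedsD(1)[OF assms(2)], rule embedsD(1)[OF assms(3)])
  fix i assume i: "i \<in> {1..pat_length P}"
  have "u (\<alpha> i) = u (\<alpha>' i)"
    using fun_cong[OF assms(4), of i] i by (simp add: compose_eq)
  moreover have "\<alpha> i \<in> {1..psize R}" "\<alpha>' i \<in> {1..psize R}"
    by (rule embedsD(3)[OF assms(2) i], rule embedsD(3)[OF assms(3) i])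
  ultimately show "\<alpha> i = \<alpha>' i" using assms(1) by (simp add: inj_on_eq_iff)
qed

text \<open>Injectivity recovers the data in the order \<open>u\<close>, \<open>R\<close>, position
  maps: \<open>u\<close> enumerates the union of the entries, \<open>R\<close> is induced along
  \<open>u\<close>, and \<alpha>, \<beta> follow by cancelling \<open>u\<close>. Surjectivity builds
  them in the same order.\<close>

lemma bij_betw_merged_occurrences:
  assumes "is_pattern P" "is_pattern P'"
  shows "bij_betw (\<lambda>((\<alpha>, \<beta>, R), u). (compose {1..pat_length P} u \<alpha>, compose {1..pat_length P'} u \<beta>))
    (SIGMA d:merge_data P P'. occurrences (merge_pattern P P' d) l)
    (occurrences P l \<times> occurrences P' l)"
proof (rule bij_betw_imageI)
  let ?f = "\<lambda>((\<alpha>, \<beta>, R :: set_partition), u).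
    (compose {1..pat_length P} u \<alpha>, compose {1..pat_length P'} u \<beta>)"
  let ?S = "SIGMA d:merge_data P P'. occurrences (merge_pattern P P' d) l"
  have part: "pat_part (merge_pattern P P' (\<alpha>, \<beta>, R)) = R" for \<alpha> \<beta> R
    by (simp add: merge_pattern_def)
  have labels: "respects_labels u (merge_pattern P P' (\<alpha>, \<beta>, R)) l \<longleftrightarrow>
      respects_labels (compose {1..pat_length P} u \<alpha>) P l \<and>
      respects_labels (compose {1..pat_length P'} u \<beta>) P' l" for u \<alpha> \<beta> R
    using respects_labels_cong[OF assms(1), of "u \<circ> \<alpha>" "compose {1..pat_length P} u \<alpha>"]
      respects_labels_cong[OF assms(2), of "u \<circ> \<beta>" "compose {1..pat_length P'} u \<beta>"]
    by (simp add: respects_labels_merge_pattern compose_eq)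
  show "inj_on ?f ?S"
  proof (rule inj_onI)
    fix y y' assume y: "y \<in> ?S" "y' \<in> ?S" "?f y = ?f y'"
    obtain \<alpha> \<beta> R u \<alpha>' \<beta>' R' u' where yy: "y = ((\<alpha>, \<beta>, R), u)" "y' = ((\<alpha>', \<beta>', R'), u')"
      by (metis prod.collapse)
    have d: "(\<alpha>, \<beta>, R) \<in> merge_data P P'" and d': "(\<alpha>', \<beta>', R') \<in> merge_data P P'"
      and "u \<in> occurrences (merge_pattern P P' (\<alpha>, \<beta>, R)) l"
      and "u' \<in> occurrences (merge_pattern P P' (\<alpha>', \<beta>', R')) l"
      and eq: "compose {1..pat_length P} u \<alpha> = compose {1..pat_length P} u' \<alpha>'"
        "compose {1..pat_length P'} u \<beta> = compose {1..pat_length P'} u' \<beta>'"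
      using y by (simp_all add: yy)
    then have u: "embeds u (merge_pattern P P' (\<alpha>, \<beta>, R)) l"
      and u': "embeds u' (merge_pattern P P' (\<alpha>', \<beta>', R')) l"
      by (simp_all add: occurrences_embeds)
    have um: "strict_mono_on {1..psize R} u" "strict_mono_on {1..psize R'} u'"
      using embedsD(2)[OF u] embedsD(2)[OF u'] by simp_all
    have im: "u ` {1..psize R} = u' ` {1..psize R'}"
      by (simp only: merged_occurrence_image[OF d] merged_occurrence_image[OF d'] eq)
    have inj: "inj_on u {1..psize R}"
      using um(1) by (rule strict_mono_on_imp_inj_on)
    \<comment> \<open>Both sizes are the cardinality of the common image, since \<open>u\<close> and
      \<open>u'\<close> are injective.\<close>
    have size: "psize R = psize R'"
      using arg_cong[OF im, of card] card_image[OF inj]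
        card_image[OF strict_mono_on_imp_inj_on[OF um(2)]] by simp
    have uu': "u = u'"
    proof (rule extensionalityI)
      show "u \<in> extensional {1..psize R}" "u' \<in> extensional {1..psize R}"
        using embedsD(1)[OF u] embedsD(1)[OF u'] size by simp_all
      show "u i = u' i" if "i \<in> {1..psize R}" for i
        using um(2) im by (intro strict_mono_on_image_unique[OF um(1) _ _ that]) (simp_all add: size)
    qed
    \<comment> \<open>Both partitions are the one that \<open>l\<close> induces along the same
      tuple.\<close>
    have RR': "R = R'"
    proof (rule set_partition_eqI[OF size])
      fix i j assume ij: "i \<in> {1..psize R}" "j \<in> {1..psize R}"
      then have "same_block l (u i) (u j) \<longleftrightarrow> same_block R i j"
        using embedsD(4)[OF u, unfolded pat_length_merge_pattern part] by blast
      moreover have "same_block l (u' i) (u' j) \<longleftrightarrow> same_block R' i j"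
        using embedsD(4)[OF u', unfolded pat_length_merge_pattern part] ij[unfolded size] by blast
      ultimately show "same_block R i j \<longleftrightarrow> same_block R' i j" using uu' by simp
    qed
    have "\<alpha> = \<alpha>'"
      using d d' eq(1) inj by (intro embeds_left_cancel[of u R \<alpha> P]) (simp_all add: merge_data_def uu' RR')
    moreover have "\<beta> = \<beta>'"
      using d d' eq(2) inj by (intro embeds_left_cancel[of u R \<beta> P']) (simp_all add: merge_data_def uu' RR')
    ultimately show "y = y'"
      using uu' RR' by (simp add: yy)
  qed
  show "?f ` ?S = occurrences P l \<times> occurrences P' l"
  proof (intro equalityI subsetI)
    fix z assume "z \<in> ?f ` ?S"
    then obtain \<alpha> \<beta> R u where d: "(\<alpha>, \<beta>, R) \<in> merge_data P P'"
      and u: "u \<in> occurrences (merge_pattern P P' (\<alpha>, \<beta>, R)) l"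
      and z: "z = (compose {1..pat_length P} u \<alpha>, compose {1..pat_length P'} u \<beta>)"
      by auto
    have "embeds \<alpha> P R" "embeds \<beta> P' R" by (rule merge_dataD[OF d])+
    moreover have emb: "embeds u (merge_pattern P P' (\<alpha>, \<beta>, R)) l"
      using u by (simp add: occurrences_embeds)
    ultimately have "embeds (compose {1..pat_length P} u \<alpha>) P l"
      "embeds (compose {1..pat_length P'} u \<beta>) P' l"
      using embeds_compose[OF emb _ part] by blast+
    then show "z \<in> occurrences P l \<times> occurrences P' l"
      using u by (simp add: z occurrences_embeds labels)
  next
    fix z assume "z \<in> occurrences P l \<times> occurrences P' l"
    then obtain x x' where z: "z = (x, x')"
      and x: "embeds x P l" "respects_labels x P l" and x': "embeds x' P' l" "respects_labels x' P' l"
      by (auto simp: occurrences_embeds)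
    define U where "U = x ` {1..pat_length P} \<union> x' ` {1..pat_length P'}"
    have "U \<subseteq> {1..psize l}"
      using embedsD(3)[OF x(1)] embedsD(3)[OF x'(1)] unfolding U_def by blast
    obtain u where u: "u \<in> {1..card U} \<rightarrow>\<^sub>E U" "strict_mono_on {1..card U} u" "u ` {1..card U} = U"
      using strict_mono_enumeration_exists[of U] by (auto simp: U_def)
    have uE: "u \<in> {1..card U} \<rightarrow>\<^sub>E {1..psize l}"
      using u(1) \<open>U \<subseteq> {1..psize l}\<close> PiE_mono[of "{1..card U}" "\<lambda>_. U" "\<lambda>_. {1..psize l}"] by auto
    then obtain R where R: "psize R = card U"
      "\<And>i j. i \<in> {1..card U} \<Longrightarrow> j \<in> {1..card U} \<Longrightarrow> same_block l (u i) (u j) \<longleftrightarrow> same_block R i j"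
      using induced_partition_exists[of u "card U" l] by (auto simp: PiE_def)
    \<comment> \<open>Embedding ignores labels, so this holds before \<alpha> and \<beta> are known
      and can be used to construct them.\<close>
    have emb: "embeds u (merge_pattern P P' (\<alpha>, \<beta>, R)) l" for \<alpha> \<beta>
      using uE u(2) R unfolding embeds_def pat_length_merge_pattern part by simp
    obtain \<alpha> where \<alpha>: "embeds \<alpha> P R" "compose {1..pat_length P} u \<alpha> = x"
      using embeds_factor[OF emb x(1) part] u(3) R(1) by (auto simp: U_def)
    obtain \<beta> where \<beta>: "embeds \<beta> P' R" "compose {1..pat_length P'} u \<beta> = x'"
      using embeds_factor[OF emb x'(1) part] u(3) R(1) by (auto simp: U_def)
    have sub: "\<alpha> ` {1..pat_length P} \<union> \<beta> ` {1..pat_length P'} \<subseteq> {1..psize R}"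
      using embedsD(3)[OF \<alpha>(1)] embedsD(3)[OF \<beta>(1)] by blast
    have "u ` (\<alpha> ` {1..pat_length P} \<union> \<beta> ` {1..pat_length P'}) = U"
      unfolding U_def \<alpha>(2)[symmetric] \<beta>(2)[symmetric] by (simp add: image_Un image_image compose_eq)
    \<comment> \<open>Both sides have image \<open>U\<close> under \<open>u\<close>, which is
      injective on [r].\<close>
    then have "\<alpha> ` {1..pat_length P} \<union> \<beta> ` {1..pat_length P'} = {1..psize R}"
      using inj_on_image_eq_iff[OF strict_mono_on_imp_inj_on[OF u(2)] sub[unfolded R(1)] order_refl]
        u(3) R(1) by simp
    then have "(\<alpha>, \<beta>, R) \<in> merge_data P P'"
      using \<alpha>(1) \<beta>(1) by (simp add: merge_data_def)
    moreover have "u \<in> occurrences (merge_pattern P P' (\<alpha>, \<beta>, R)) l"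
      unfolding occurrences_embeds labels \<alpha>(2) \<beta>(2) by (intro conjI emb x(2) x'(2))
    ultimately have "((\<alpha>, \<beta>, R), u) \<in> ?S" by blast
    moreover have "z = ?f ((\<alpha>, \<beta>, R), u)" by (simp only: prod.case z \<alpha>(2) \<beta>(2))
    ultimately show "z \<in> ?f ` ?S" by (rule rev_image_eqI)
  qed
qed

lemma finite_occurrences: "finite (occurrences P l)"
  by (rule finite_subset[of _ "{1..pat_length P} \<rightarrow>\<^sub>E {1..psize l}"])
    (auto simp: occurrences_def intro: finite_PiE)


section \<open>The filtration by degree\<close>

text \<open>Asking for some representation of bounded degree avoids the minimum in
  \<open>stat_degree\<close>: closure properties then only require exhibiting a
  representation.\<close>

definition stats_upto :: "nat \<Rightarrow> (set_partition \<Rightarrow> rat) set" where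
  "stats_upto d = {f. \<exists>T c. represents T c f \<and> representation_degree T \<le> d}"

lemma represents_finite: "represents T c f \<Longrightarrow> finite T"
  by (simp add: represents_def)

lemma representation_degree_le_iff:
  "finite T \<Longrightarrow> representation_degree T \<le> d \<longleftrightarrow> (\<forall>t\<in>T. simple_degree t \<le> d)"
  by (auto simp: representation_degree_def)

text \<open>A nonempty set of natural numbers attains its minimum, so a statistic has a
  representation whose degree is exactly \<open>stat_degree f\<close>.\<close>

lemma stats_upto_iff: "f \<in> stats_upto d \<longleftrightarrow> f \<in> statistics \<and> stat_degree f \<le> d"
proof
  assume "f \<in> stats_upto d"
  then obtain T c where T: "represents T c f" "representation_degree T \<le> d"
    by (auto simp: stats_upto_def)
  then have "stat_degree f \<le> representation_degree T"
    unfolding stat_degree_def by (intro Least_le) blast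
  with T show "f \<in> statistics \<and> stat_degree f \<le> d"
    by (auto simp: statistics_def)
next
  assume f: "f \<in> statistics \<and> stat_degree f \<le> d"
  then have "\<exists>e T c. represents T c f \<and> representation_degree T = e"
    by (auto simp: statistics_def)
  then have "\<exists>T c. represents T c f \<and> representation_degree T = stat_degree f"
    unfolding stat_degree_def by (rule LeastI_ex)
  with f show "f \<in> stats_upto d" by (auto simp: stats_upto_def)
qed

lemma stats_upto_simple:
  assumes "t \<in> simple_data" "simple_degree t \<le> d"
  shows "simple_stat t \<in> stats_upto d"
proof -
  have "represents {t} (\<lambda>_. 1) (simple_stat t)"
    using assms by (simp add: represents_def)
  moreover have "representation_degree {t} \<le> d"
    using assms by (simp add: representation_degree_le_iff)
  ultimately show ?thesis by (auto simp: stats_upto_def)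
qed

lemma stats_upto_zero: "(\<lambda>l. 0) \<in> stats_upto d"
proof -
  have "represents {} c (\<lambda>l. 0)" "representation_degree {} \<le> d" for c
    by (simp_all add: represents_def representation_degree_def)
  then show ?thesis unfolding stats_upto_def by blast
qed

lemma stats_upto_scale:
  assumes "f \<in> stats_upto d"
  shows "(\<lambda>l. a * f l) \<in> stats_upto d"
proof -
  obtain T c where T: "represents T c f" "representation_degree T \<le> d"
    using assms by (auto simp: stats_upto_def)
  then have "represents T (\<lambda>t. a * c t) (\<lambda>l. a * f l)"
    by (simp add: represents_def sum_distrib_left mult.assoc)
  with T show ?thesis by (auto simp: stats_upto_def)
qed

lemma stats_upto_add:
  assumes "f \<in> stats_upto d" "g \<in> stats_upto d"
  shows "(\<lambda>l. f l + g l) \<in> stats_upto d"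
proof -
  obtain T c where T: "represents T c f" "representation_degree T \<le> d"
    using assms by (auto simp: stats_upto_def)
  obtain T' c' where T': "represents T' c' g" "representation_degree T' \<le> d"
    using assms by (auto simp: stats_upto_def)
  have fin: "finite T" "finite T'" using T T' represents_finite by auto
  \<comment> \<open>The two representations may share simple statistics; coefficients are extended
    by 0 and added on the union.\<close>
  define b where "b t = (if t \<in> T then c t else 0) + (if t \<in> T' then c' t else 0)" for t
  have "f l + g l = (\<Sum>t\<in>T \<union> T'. b t * simple_stat t l)" for l
  proof -
    have "f l = (\<Sum>t\<in>T \<union> T'. (if t \<in> T then c t else 0) * simple_stat t l)"
      using T fin by (auto simp: represents_def intro!: sum.mono_neutral_cong_left)
    moreover have "g l = (\<Sum>t\<in>T \<union> T'. (if t \<in> T' then c' t else 0) * simple_stat t l)"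
      using T' fin by (auto simp: represents_def intro!: sum.mono_neutral_cong_left)
    ultimately show ?thesis by (simp only: b_def distrib_right sum.distrib)
  qed
  then have "represents (T \<union> T') b (\<lambda>l. f l + g l)"
    using T T' by (auto simp: represents_def)
  moreover have "representation_degree (T \<union> T') \<le> d"
    using T T' fin by (auto simp: representation_degree_le_iff)
  ultimately show ?thesis by (auto simp: stats_upto_def)
qed

lemma stats_upto_sum:
  assumes "finite A" "\<And>a. a \<in> A \<Longrightarrow> f a \<in> stats_upto d"
  shows "(\<lambda>l. \<Sum>a\<in>A. f a l) \<in> stats_upto d"
  using assms by (induction A rule: finite_induct) (auto simp: stats_upto_zero stats_upto_add)

text \<open>The pattern of length 0 with the constant polynomial 1: every partition contains exactly
  one empty tuple.\<close>

lemma stats_upto_one: "(\<lambda>l. 1) \<in> stats_upto 0"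
proof -
  obtain E where E: "blocks E = {}" "psize E = 0"
    using ex_set_partition[of 0 "{}"] by (auto simp: partition_on_def)
  define P where "P = \<lparr>pat_part = E, pat_F = {}, pat_L = {}, pat_A = {}, pat_C = {}\<rparr>"
  define t :: "pattern \<times> int_mpoly" where "t = (P, Poly_Mapping.single 0 1)"
  have len: "pat_length P = 0" by (simp add: P_def pat_length_def E)
  \<comment> \<open>The empty tuple is the only extensional function on the empty set.\<close>
  have "occurrences P l = {\<lambda>_. undefined}" for l
    unfolding occurrences_def len by (simp add: P_def strict_mono_on_def)
  then have "simple_stat t = (\<lambda>l. 1)"
    by (simp add: simple_stat_def t_def mpoly_eval_def)
  moreover have "t \<in> simple_data"
    by (auto simp: simple_data_def t_def is_pattern_def P_def mpoly_vars_def)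
  moreover have "simple_degree t \<le> 0"
    by (simp add: simple_degree_def t_def len mpoly_degree_def)
  ultimately show ?thesis using stats_upto_simple by metis
qed

section \<open>Products and the filtered algebra\<close>

text \<open>The product is a sum over pairs of occurrences; the bijection regroups it by merge
  datum, and each group is one simple statistic. Lengths and polynomial degrees are bounded
  separately by sums.\<close>

lemma simple_stat_mult:
  assumes "(P, Q) \<in> simple_data" "(P', Q') \<in> simple_data"
  shows "(\<lambda>l. simple_stat (P, Q) l * simple_stat (P', Q') l)
    \<in> stats_upto (simple_degree (P, Q) + simple_degree (P', Q'))"
proof -
  let ?D = "simple_degree (P, Q) + simple_degree (P', Q')"
  \<comment> \<open>Index 0 stands for the variable m, which is common to both polynomials and must
    stay fixed under renaming.\<close>
  let ?ext = "\<lambda>\<alpha> i. if i = 0 then 0 else \<alpha> i :: nat"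
  let ?val = "\<lambda>l x i. if i = 0 then int (psize l) else int (x i)"
  have P: "is_pattern P" "is_pattern P'" and vars: "mpoly_vars Q \<subseteq> {0..pat_length P}"
      "mpoly_vars Q' \<subseteq> {0..pat_length P'}"
    using assms by (simp_all add: simple_data_def)
  have "\<exists>S. (\<forall>v. mpoly_eval v S =
        mpoly_eval (v \<circ> ?ext \<alpha>) Q * mpoly_eval (v \<circ> ?ext \<beta>) Q') \<and>
      mpoly_vars S \<subseteq> {0..psize R} \<and> mpoly_degree S \<le> mpoly_degree Q + mpoly_degree Q'"
    if d: "(\<alpha>, \<beta>, R) \<in> merge_data P P'" for \<alpha> \<beta> R
  proof (rule mpoly_rename_mult_exists)
    have "\<alpha> i \<in> {1..psize R}" if "i \<in> {1..pat_length P}" for i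
      using embedsD(3)[OF merge_dataD(1)[OF d] that] .
    then show "?ext \<alpha> ` mpoly_vars Q \<subseteq> {0..psize R}" using vars(1) by fastforce
    have "\<beta> i \<in> {1..psize R}" if "i \<in> {1..pat_length P'}" for i
      using embedsD(3)[OF merge_dataD(2)[OF d] that] .
    then show "?ext \<beta> ` mpoly_vars Q' \<subseteq> {0..psize R}" using vars(2) by fastforce
  qed
  then have "\<forall>d\<in>merge_data P P'. \<exists>S. (\<forall>v. mpoly_eval v S =
        mpoly_eval (v \<circ> ?ext (fst d)) Q * mpoly_eval (v \<circ> ?ext (fst (snd d))) Q') \<and>
      mpoly_vars S \<subseteq> {0..psize (snd (snd d))} \<and>
      mpoly_degree S \<le> mpoly_degree Q + mpoly_degree Q'"
    by (simp add: split_paired_all)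
  \<comment> \<open>The polynomial is chosen before any partition \<open>l\<close> is fixed: it
    depends on the merge datum only.\<close>
  from bchoice[OF this] obtain S where S: "\<forall>d\<in>merge_data P P'. (\<forall>v. mpoly_eval v (S d) =
        mpoly_eval (v \<circ> ?ext (fst d)) Q * mpoly_eval (v \<circ> ?ext (fst (snd d))) Q') \<and>
      mpoly_vars (S d) \<subseteq> {0..psize (snd (snd d))} \<and>
      mpoly_degree (S d) \<le> mpoly_degree Q + mpoly_degree Q'" ..
  have in_stats: "simple_stat (merge_pattern P P' d, S d) \<in> stats_upto ?D"
    if d: "d \<in> merge_data P P'" for d
  proof (rule stats_upto_simple)
    obtain \<alpha> \<beta> R where dd: "d = (\<alpha>, \<beta>, R)" by (cases d)
    show "(merge_pattern P P' d, S d) \<in> simple_data"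
      using bspec[OF S d] is_pattern_merge_pattern[OF P] d by (simp add: simple_data_def dd)
    show "simple_degree (merge_pattern P P' d, S d) \<le> ?D"
      using bspec[OF S d] merge_data_psize_le[of \<alpha> \<beta> R P P'] d by (simp add: simple_degree_def dd)
  qed
  \<comment> \<open>At index 0 both valuations give n. At an index in [k] the position given by
    \<alpha> is at least 1, so it is never confused with the variable m. Other indices do not occur
    in \<open>q\<close>.\<close>
  have val: "mpoly_eval (?val l u \<circ> ?ext \<alpha>) q = mpoly_eval (?val l (compose {1..pat_length p} u \<alpha>)) q"
    if "embeds \<alpha> p R" "mpoly_vars q \<subseteq> {0..pat_length p}" for l u \<alpha> q p R
  proof (rule mpoly_eval_cong)
    fix i assume "i \<in> mpoly_vars q"
    then have "i \<noteq> 0 \<Longrightarrow> i \<in> {1..pat_length p}" using that(2) by auto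
    moreover note embedsD(3)[OF that(1), of i]
    ultimately show "(?val l u \<circ> ?ext \<alpha>) i = ?val l (compose {1..pat_length p} u \<alpha>) i"
      by (auto simp: compose_eq)
  qed
  have "simple_stat (P, Q) l * simple_stat (P', Q') l =
      (\<Sum>d\<in>merge_data P P'. simple_stat (merge_pattern P P' d, S d) l)" for l
  proof -
    let ?g = "\<lambda>(x, x'). of_int (mpoly_eval (?val l x) Q * mpoly_eval (?val l x') Q') :: rat"
    let ?f = "\<lambda>((\<alpha>, \<beta>, R :: set_partition), u).
      (compose {1..pat_length P} u \<alpha>, compose {1..pat_length P'} u \<beta>)"
    have "simple_stat (P, Q) l * simple_stat (P', Q') l =
        (\<Sum>z\<in>occurrences P l \<times> occurrences P' l. ?g z)"
      by (simp add: simple_stat_def sum_product sum.cartesian_product)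
    also have "\<dots> = (\<Sum>y\<in>(SIGMA d:merge_data P P'. occurrences (merge_pattern P P' d) l). ?g (?f y))"
      by (rule sum.reindex_bij_betw[OF bij_betw_merged_occurrences[OF P], symmetric])
    also have "\<dots> = (\<Sum>d\<in>merge_data P P'. \<Sum>u\<in>occurrences (merge_pattern P P' d) l. ?g (?f (d, u)))"
      by (subst sum.Sigma) (auto simp: finite_merge_data finite_occurrences intro!: sum.cong)
    also have "\<dots> = (\<Sum>d\<in>merge_data P P'. simple_stat (merge_pattern P P' d, S d) l)"
    proof (rule sum.cong[OF refl])
      fix d assume d: "d \<in> merge_data P P'"
      obtain \<alpha> \<beta> R where dd: "d = (\<alpha>, \<beta>, R)" by (cases d)
      have emb: "embeds \<alpha> P R" "embeds \<beta> P' R" using d by (simp_all add: dd merge_data_def)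
      have "mpoly_eval v (S d) =
          mpoly_eval (v \<circ> ?ext (fst d)) Q * mpoly_eval (v \<circ> ?ext (fst (snd d))) Q'" for v
        using bspec[OF S d] by blast
      then have "?g (?f (d, u)) = of_int (mpoly_eval (?val l u) (S d))" for u
        by (simp only: dd fst_conv snd_conv prod.case
            val[OF emb(1) vars(1)] val[OF emb(2) vars(2)])
      then show "(\<Sum>u\<in>occurrences (merge_pattern P P' d) l. ?g (?f (d, u))) =
          simple_stat (merge_pattern P P' d, S d) l"
        by (simp add: simple_stat_def)
    qed
    finally show ?thesis .
  qed
  then show ?thesis
    using stats_upto_sum[OF finite_merge_data in_stats] by simp
qed

lemma stats_upto_mono: "d \<le> e \<Longrightarrow> stats_upto d \<subseteq> stats_upto e"
  by (auto simp: stats_upto_iff)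

text \<open>Bilinearity reduces this to products of simple statistics, each of which lies in its own
  stage and so, by monotonicity, in stage d + e.\<close>

lemma stats_upto_mult:
  assumes "f \<in> stats_upto d" "g \<in> stats_upto e"
  shows "(\<lambda>l. f l * g l) \<in> stats_upto (d + e)"
proof -
  obtain T c where T: "represents T c f" "representation_degree T \<le> d"
    using assms by (auto simp: stats_upto_def)
  obtain T' c' where T': "represents T' c' g" "representation_degree T' \<le> e"
    using assms by (auto simp: stats_upto_def)
  have fin: "finite T" "finite T'" using T T' represents_finite by auto
  have "(\<lambda>l. simple_stat t l * simple_stat t' l) \<in> stats_upto (d + e)"
    if "t \<in> T" "t' \<in> T'" for t t'
  proof -
    have "t \<in> simple_data" "t' \<in> simple_data"
      using that T T' by (auto simp: represents_def)
    then have "(\<lambda>l. simple_stat t l * simple_stat t' l)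
        \<in> stats_upto (simple_degree t + simple_degree t')"
      using simple_stat_mult[of "fst t" "snd t" "fst t'" "snd t'"] by simp
    moreover have "simple_degree t + simple_degree t' \<le> d + e"
      using that T T' fin by (intro add_mono) (auto simp: representation_degree_le_iff)
    ultimately show ?thesis using stats_upto_mono by blast
  qed
  then have "(\<lambda>l. \<Sum>t\<in>T. \<Sum>t'\<in>T'. c t * c' t' * (simple_stat t l * simple_stat t' l))
      \<in> stats_upto (d + e)"
    using fin by (intro stats_upto_sum stats_upto_scale) auto
  moreover have "f l * g l =
      (\<Sum>t\<in>T. \<Sum>t'\<in>T'. c t * c' t' * (simple_stat t l * simple_stat t' l))" for l
  proof -
    have "f l = (\<Sum>t\<in>T. c t * simple_stat t l)" "g l = (\<Sum>t\<in>T'. c' t * simple_stat t l)"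
      using T T' by (auto simp: represents_def)
    then show ?thesis by (simp only: sum_product mult.assoc mult.left_commute)
  qed
  ultimately show ?thesis by simp
qed

lemma in_stats_upto_stat_degree: "f \<in> statistics \<Longrightarrow> f \<in> stats_upto (stat_degree f)"
  by (simp add: stats_upto_iff)

lemma filtered_algebra_statistics:
  "filtered_algebra (\<lambda>(a::rat) f l. a * f l) statistics stats_upto"
proof -
  let ?sc = "\<lambda>(a::rat) f (l::set_partition). a * f l"
  have vs: "vector_space ?sc"
    by unfold_locales (auto simp: fun_eq_iff algebra_simps)
  then have m: "module ?sc"
    by (simp add: module_iff_vector_space)
  have F: "module.subspace ?sc (stats_upto d)" for d
    using stats_upto_zero[of d] stats_upto_add[of _ d] stats_upto_scale[of _ d]
    by (simp add: module.subspace_def[OF m] zero_fun_def plus_fun_def)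
  have U: "(\<Union>d. stats_upto d) = statistics"
    by (auto simp: stats_upto_iff)
  have A0: "(\<lambda>l. 0) \<in> statistics" and A1: "(\<lambda>l. 1) \<in> statistics"
    using stats_upto_zero stats_upto_one by (auto simp: stats_upto_iff)
  have add: "(\<lambda>l. f l + g l) \<in> statistics" if "f \<in> statistics" "g \<in> statistics" for f g
  proof -
    \<comment> \<open>Two statistics of different degrees are added in a common stage of the
      filtration.\<close>
    have "f \<in> stats_upto (max (stat_degree f) (stat_degree g))"
      "g \<in> stats_upto (max (stat_degree f) (stat_degree g))"
      using that by (auto simp: stats_upto_iff)
    then show ?thesis using stats_upto_add stats_upto_iff by blast
  qed
  have scale: "(\<lambda>l. a * f l) \<in> statistics" if "f \<in> statistics" for a f
    using stats_upto_scale[OF in_stats_upto_stat_degree[OF that]] stats_upto_iff by blast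
  have mult: "(\<lambda>l. f l * g l) \<in> statistics" if "f \<in> statistics" "g \<in> statistics" for f g
    using stats_upto_mult[OF in_stats_upto_stat_degree[OF that(1)] in_stats_upto_stat_degree[OF that(2)]]
      stats_upto_iff by blast
  have "module.subspace ?sc statistics"
    using A0 add scale by (simp add: module.subspace_def[OF m] zero_fun_def plus_fun_def)
  then show ?thesis
    unfolding filtered_algebra_def
    using vs F U A1 mult stats_upto_mono stats_upto_one stats_upto_mult
    by (auto simp: times_fun_def one_fun_def fun_eq_iff)
qed

theorem theorem2p2:
  shows "(\<forall>f1\<in>statistics. \<forall>f2\<in>statistics. \<forall>a::rat.
           \<exists>g_a\<in>statistics. \<exists>g_plus\<in>statistics. \<exists>g_times\<in>statistics.
             (\<forall>l. a * f1 l = g_a l \<and> f1 l + f2 l = g_plus l \<and> f1 l * f2 l = g_times l) \<and>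
             stat_degree g_a \<le> stat_degree f1 \<and>
             stat_degree g_plus \<le> max (stat_degree f1) (stat_degree f2) \<and>
             stat_degree g_times \<le> stat_degree f1 + stat_degree f2)
       \<and> filtered_algebra (\<lambda>(a::rat) f l. a * f l) statistics
           (\<lambda>d. {f \<in> statistics. stat_degree f \<le> d})"
proof (intro conjI ballI allI)
  fix f1 f2 and a :: rat
  assume f: "f1 \<in> statistics" "f2 \<in> statistics"
  let ?m = "max (stat_degree f1) (stat_degree f2)"
  have "(\<lambda>l. a * f1 l) \<in> stats_upto (stat_degree f1)"
    using f by (intro stats_upto_scale in_stats_upto_stat_degree)
  moreover have "(\<lambda>l. f1 l + f2 l) \<in> stats_upto ?m"
    using f by (intro stats_upto_add) (auto simp: stats_upto_iff)
  moreover have "(\<lambda>l. f1 l * f2 l) \<in> stats_upto (stat_degree f1 + stat_degree f2)"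
    using f by (intro stats_upto_mult in_stats_upto_stat_degree)
  ultimately show "\<exists>g_a\<in>statistics. \<exists>g_plus\<in>statistics. \<exists>g_times\<in>statistics.
      (\<forall>l. a * f1 l = g_a l \<and> f1 l + f2 l = g_plus l \<and> f1 l * f2 l = g_times l) \<and>
      stat_degree g_a \<le> stat_degree f1 \<and> stat_degree g_plus \<le> ?m \<and>
      stat_degree g_times \<le> stat_degree f1 + stat_degree f2"
    unfolding stats_upto_iff
    by (intro bexI[of _ "\<lambda>l. a * f1 l"] bexI[of _ "\<lambda>l. f1 l + f2 l"] bexI[of _ "\<lambda>l. f1 l * f2 l"])
      simp_all
next
  have "stats_upto = (\<lambda>d. {f \<in> statistics. stat_degree f \<le> d})"
    by (auto simp: fun_eq_iff stats_upto_iff)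
  then show "filtered_algebra (\<lambda>(a::rat) f l. a * f l) statistics
      (\<lambda>d. {f \<in> statistics. stat_degree f \<le> d})"
    using filtered_algebra_statistics by simp
qed

end
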